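(* Let $n\ge 1$, let $\{u_1,\dots,u_n\}\subset H^2$ be orthonormal and let $\{v_1,\dots,v_n\}\subset H^2$ be an orthogonal set of nonzero vectors. Suppose $g=0$ almost everywhere on $\mathbb{T}$, and let $R_n:H^2\to H^2$ be given by $R_n h=T_g h+\sum_{i=1}^n\langle h,u_i\rangle v_i$. Then the subspace $\ker R_n$ is nearly $S^*$-invariant with defect $n$ and defect space $F=\operatorname{span}\{u_i : i=1,\dots,n\}$.
   Context: $H^2$ is the Hardy space of the unit disc $\mathbb{D}$, identified via boundary values with a closed subspace of $L^2(\mathbb{T})$; $P:L^2(\mathbb{T})\to H^2$ is the orthogonal projection; for $g\in L^\infty(\mathbb{T})$ the Toeplitz operator is $T_g f=P(gf)$ for $f\in H^2$. The backward shift is $S^*f(z)=(f(z)-f(0))/z$. A subspace $M\subset H^2$ is nearly $S^*$-invariant with defect $m$ if there is an $m$-dimensional subspace $F$ such that $S^*f\in M+F$ whenever $f\in M$ and $f(0)=0$; $F$ is called the defect space. *)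

theory Defs
  imports "HOL-Complex_Analysis.Complex_Analysis"
begin

text \<open>
  The unit circle with normalised arc length.  The underlying space is the circle itself (not the
  plane), so that measurability of a function only concerns its values on the circle.
\<close>

definition circle :: "complex measure" where
  "circle = distr (uniform_measure lborel {0..<2 * pi}) (restrict_space borel (sphere 0 1)) cis"

definition square_integrable :: "(complex \<Rightarrow> complex) \<Rightarrow> bool" where
  "square_integrable f \<longleftrightarrow> f \<in> borel_measurable circle \<and> integrable circle (\<lambda>z. (cmod (f z))\<^sup>2)"

lemma square_integrable_0: "square_integrable (\<lambda>_. 0)"
  by (simp add: square_integrable_def)

lemma square_integrable_add:
  assumes "square_integrable f" "square_integrable g"
  shows "square_integrable (\<lambda>z. f z + g z)"
proof -
  have [measurable]: "f \<in> borel_measurable circle" "g \<in> borel_measurable circle"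
    using assms by (auto simp: square_integrable_def)
  have le: "(cmod (a + b))\<^sup>2 \<le> 2 * (cmod a)\<^sup>2 + 2 * (cmod b)\<^sup>2" for a b
  proof -
    have "(cmod (a + b))\<^sup>2 \<le> (cmod a + cmod b)\<^sup>2"
      by (intro power_mono norm_triangle_ineq norm_ge_zero)
    also have "\<dots> \<le> 2 * (cmod a)\<^sup>2 + 2 * (cmod b)\<^sup>2"
      using sum_squares_bound[of "cmod a" "cmod b"] by (simp add: power2_sum)
    finally show ?thesis .
  qed
  have "integrable circle (\<lambda>z. 2 * (cmod (f z))\<^sup>2 + 2 * (cmod (g z))\<^sup>2)"
    using assms by (auto simp: square_integrable_def)
  then have "integrable circle (\<lambda>z. (cmod (f z + g z))\<^sup>2)"
    by (rule Bochner_Integration.integrable_bound) (auto intro!: AE_I2 le simp: abs_of_nonneg)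
  then show ?thesis
    by (simp add: square_integrable_def)
qed

lemma square_integrable_cmult:
  assumes "square_integrable f"
  shows "square_integrable (\<lambda>z. c * f z)"
  using assms by (auto simp: square_integrable_def norm_mult power_mult_distrib)

lemma square_integrable_uminus:
  assumes "square_integrable f"
  shows "square_integrable (\<lambda>z. - f z)"
  using square_integrable_cmult[OF assms, of "-1"] by simp

lemma square_integrable_diff:
  assumes "square_integrable f" "square_integrable g"
  shows "square_integrable (\<lambda>z. f z - g z)"
  using square_integrable_add[OF assms(1) square_integrable_uminus[OF assms(2)]] by simp

definition ess_bounded :: "(complex \<Rightarrow> complex) \<Rightarrow> bool" where
  "ess_bounded g \<longleftrightarrow> g \<in> borel_measurable circle \<and> (\<exists>C. AE z in circle. cmod (g z) \<le> C)"

lemma square_integrable_mult: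
  assumes "ess_bounded g" "square_integrable f"
  shows "square_integrable (\<lambda>z. g z * f z)"
proof -
  have [measurable]: "f \<in> borel_measurable circle" "g \<in> borel_measurable circle"
    using assms by (auto simp: square_integrable_def ess_bounded_def)
  obtain C where C: "AE z in circle. cmod (g z) \<le> C"
    using assms by (auto simp: ess_bounded_def)
  have int: "integrable circle (\<lambda>z. C\<^sup>2 * (cmod (f z))\<^sup>2)"
    using assms by (auto simp: square_integrable_def)
  have le: "AE z in circle. norm ((cmod (g z * f z))\<^sup>2) \<le> norm (C\<^sup>2 * (cmod (f z))\<^sup>2)"
    using C
  proof eventually_elim
    case (elim z)
    then have "(cmod (g z))\<^sup>2 \<le> C\<^sup>2"
      by (intro power_mono) auto
    then show ?case
      by (simp add: norm_mult power_mult_distrib mult_right_mono)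
  qed
  have meas: "(\<lambda>z. (cmod (g z * f z))\<^sup>2) \<in> borel_measurable circle"
    by measurable
  from int meas le have "integrable circle (\<lambda>z. (cmod (g z * f z))\<^sup>2)"
    by (rule Bochner_Integration.integrable_bound)
  then show ?thesis
    by (simp add: square_integrable_def)
qed

quotient_type L2T = "complex \<Rightarrow> complex" / partial:
  "\<lambda>f g. square_integrable f \<and> square_integrable g \<and> (AE z in circle. f z = g z)"
proof (rule part_equivpI)
  show "\<exists>f. square_integrable f \<and> square_integrable f \<and> (AE z in circle. f z = f z)"
    using square_integrable_0 by auto
  show "symp (\<lambda>f g. square_integrable f \<and> square_integrable g \<and> (AE z in circle. f z = g z))"
    by (auto intro!: sympI simp: eq_commute)
  show "transp (\<lambda>f g. square_integrable f \<and> square_integrable g \<and> (AE z in circle. f z = g z))"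
  proof (rule transpI, intro conjI)
    fix f g h
    assume a: "square_integrable f \<and> square_integrable g \<and> (AE z in circle. f z = g z)"
      and b: "square_integrable g \<and> square_integrable h \<and> (AE z in circle. g z = h z)"
    from a show "square_integrable f" by blast
    from b show "square_integrable h" by blast
    have "AE z in circle. f z = g z" "AE z in circle. g z = h z"
      using a b by blast+
    then show "AE z in circle. f z = h z"
      by eventually_elim simp
  qed
qed

instantiation L2T :: ab_group_add
begin

lift_definition zero_L2T :: L2T is "\<lambda>_. 0"
  by (simp add: square_integrable_0)

lift_definition plus_L2T :: "L2T \<Rightarrow> L2T \<Rightarrow> L2T" is "\<lambda>f g z. f z + g z"
  by (auto intro!: square_integrable_add)

lift_definition uminus_L2T :: "L2T \<Rightarrow> L2T" is "\<lambda>f z. - f z"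
  by (auto intro!: square_integrable_uminus)

lift_definition minus_L2T :: "L2T \<Rightarrow> L2T \<Rightarrow> L2T" is "\<lambda>f g z. f z - g z"
  by (auto intro!: square_integrable_diff)

instance
proof
  fix a b c :: L2T
  show "a + b + c = a + (b + c)"
    by transfer (auto intro!: square_integrable_add simp: algebra_simps)
  show "a + b = b + a"
    by transfer (auto intro!: square_integrable_add simp: algebra_simps)
  show "0 + a = a"
    by transfer auto
  show "- a + a = 0"
    by transfer (auto simp: square_integrable_0)
  show "a - b = a + - b"
    by transfer (auto intro!: square_integrable_diff)
qed

end

lift_definition scaleC :: "complex \<Rightarrow> L2T \<Rightarrow> L2T" (infixr \<open>*\<^sub>C\<close> 75) is "\<lambda>c f z. c * f z"
  by (auto intro!: square_integrable_cmult)

interpretation L2T: vector_space scaleC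
proof
  fix a b :: complex and x y :: L2T
  show "a *\<^sub>C (x + y) = a *\<^sub>C x + a *\<^sub>C y"
    by transfer (auto intro!: square_integrable_cmult square_integrable_add simp: algebra_simps)
  show "(a + b) *\<^sub>C x = a *\<^sub>C x + b *\<^sub>C x"
    by transfer (auto intro!: square_integrable_cmult square_integrable_add simp: distrib_right)
  show "a *\<^sub>C b *\<^sub>C x = (a * b) *\<^sub>C x"
    by transfer (auto intro!: square_integrable_cmult simp: mult.assoc)
  show "1 *\<^sub>C x = x"
    by transfer auto
qed

lift_definition inner_L2 :: "L2T \<Rightarrow> L2T \<Rightarrow> complex" is
  "\<lambda>f g. LINT z|circle. f z * cnj (g z)"
proof -
  fix f f' g g' :: "complex \<Rightarrow> complex"
  assume a: "square_integrable f \<and> square_integrable f' \<and> (AE z in circle. f z = f' z)"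
    and b: "square_integrable g \<and> square_integrable g' \<and> (AE z in circle. g z = g' z)"
  have [measurable]: "f \<in> borel_measurable circle" "f' \<in> borel_measurable circle"
    "g \<in> borel_measurable circle" "g' \<in> borel_measurable circle"
    using a b by (auto simp: square_integrable_def)
  have [measurable]: "cnj \<in> borel_measurable borel"
    by (intro borel_measurable_continuous_onI continuous_intros)
  have "AE z in circle. f z = f' z" "AE z in circle. g z = g' z"
    using a b by blast+
  then have "AE z in circle. f z * cnj (g z) = f' z * cnj (g' z)"
    by eventually_elim simp
  then show "(LINT z|circle. f z * cnj (g z)) = (LINT z|circle. f' z * cnj (g' z))"
    by (intro integral_cong_AE) measurable
qed

definition norm_L2 :: "L2T \<Rightarrow> real" where
  "norm_L2 f = sqrt (Re (inner_L2 f f))"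

definition hardy_disc :: "(complex \<Rightarrow> complex) set" where
  "hardy_disc = {F. F holomorphic_on ball 0 1 \<and>
     (\<exists>C. \<forall>r\<in>{0..<1}. (LINT z|circle. (cmod (F (of_real r * z)))\<^sup>2) \<le> C)}"

text \<open>Boundary values are radial limits almost everywhere.\<close>

lift_definition has_boundary_values :: "(complex \<Rightarrow> complex) \<Rightarrow> L2T \<Rightarrow> bool" is
  "\<lambda>F f. AE z in circle. ((\<lambda>r. F (of_real r * z)) \<longlongrightarrow> f z) (at_left (1::real))"
proof -
  fix F f g :: "complex \<Rightarrow> complex"
  assume "square_integrable f \<and> square_integrable g \<and> (AE z in circle. f z = g z)"
  then have ae: "AE z in circle. f z = g z"
    by blast
  show "(AE z in circle. ((\<lambda>r. F (of_real r * z)) \<longlongrightarrow> f z) (at_left (1::real))) =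
        (AE z in circle. ((\<lambda>r. F (of_real r * z)) \<longlongrightarrow> g z) (at_left (1::real)))"
    by (rule eventually_subst) (use ae in \<open>auto elim!: eventually_mono\<close>)
qed

text \<open>The Hardy space, regarded as a subspace of \<open>L\<^sup>2\<close> of the circle.\<close>

definition H2 :: "L2T set" where
  "H2 = {f. \<exists>F\<in>hardy_disc. has_boundary_values F f}"

text \<open>
  The function on the disc that \<^term>\<open>f \<in> H2\<close> is identified with.  Its values on the open disc are
  uniquely determined by \<^term>\<open>f\<close>; the values elsewhere are arbitrary and never used.
\<close>

definition disc_fun :: "L2T \<Rightarrow> complex \<Rightarrow> complex" where
  "disc_fun f = (SOME F. F \<in> hardy_disc \<and> has_boundary_values F f)"

text \<open>The value at \<open>0\<close> fills in the removable singularity of the difference quotient.\<close>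

definition backward_shift_disc :: "(complex \<Rightarrow> complex) \<Rightarrow> complex \<Rightarrow> complex" where
  "backward_shift_disc F z = (if z = 0 then deriv F 0 else (F z - F 0) / z)"

definition backward_shift :: "L2T \<Rightarrow> L2T" where
  "backward_shift f = (THE h. has_boundary_values (backward_shift_disc (disc_fun f)) h)"

definition orthogonal_projection :: "L2T set \<Rightarrow> L2T \<Rightarrow> L2T" where
  "orthogonal_projection V f = (THE p. p \<in> V \<and> (\<forall>q\<in>V. inner_L2 (f - p) q = 0))"

text \<open>The guard only makes the product total; it is meant for essentially bounded \<^term>\<open>g\<close>.\<close>

lift_definition mult_L2 :: "(complex \<Rightarrow> complex) \<Rightarrow> L2T \<Rightarrow> L2T" is
  "\<lambda>g f. if ess_bounded g then (\<lambda>z. g z * f z) else (\<lambda>_. 0)"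
  by (auto intro!: square_integrable_mult square_integrable_0)

definition toeplitz :: "(complex \<Rightarrow> complex) \<Rightarrow> L2T \<Rightarrow> L2T" where
  "toeplitz g f = orthogonal_projection H2 (mult_L2 g f)"

definition kernel_H2 :: "(L2T \<Rightarrow> L2T) \<Rightarrow> L2T set" where
  "kernel_H2 R = {h \<in> H2. R h = 0}"

text \<open>As usual for Hilbert spaces, a subspace \<^term>\<open>M\<close> of \<^term>\<open>H2\<close> is meant to be norm closed.\<close>

definition closed_subspace_H2 :: "L2T set \<Rightarrow> bool" where
  "closed_subspace_H2 M \<longleftrightarrow> M \<subseteq> H2 \<and> L2T.subspace M \<and>
     (\<forall>x h. (\<forall>k::nat. x k \<in> M) \<and> h \<in> H2 \<and> (\<lambda>k. norm_L2 (x k - h)) \<longlonglongrightarrow> 0 \<longrightarrow> h \<in> M)"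

definition has_dimension :: "L2T set \<Rightarrow> nat \<Rightarrow> bool" where
  "has_dimension F m \<longleftrightarrow> (\<exists>B. finite B \<and> card B = m \<and> \<not> L2T.dependent B \<and> L2T.span B = F)"

definition defect_space :: "L2T set \<Rightarrow> nat \<Rightarrow> L2T set \<Rightarrow> bool" where
  "defect_space M m F \<longleftrightarrow> F \<subseteq> H2 \<and> L2T.subspace F \<and> has_dimension F m \<and>
     (\<forall>f\<in>M. disc_fun f 0 = 0 \<longrightarrow> (\<exists>x\<in>M. \<exists>y\<in>F. backward_shift f = x + y))"

definition nearly_invariant_with_defect :: "L2T set \<Rightarrow> nat \<Rightarrow> bool" where
  "nearly_invariant_with_defect M m \<longleftrightarrow> closed_subspace_H2 M \<and> (\<exists>F. defect_space M m F)"

end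

theory Submission
  imports Defs "HOL-Probability.Probability_Measure"
begin

text \<open>
  Since \<open>g\<close> vanishes almost everywhere, \<open>T\<^sub>g = 0\<close> and \<open>R h\<close> is the finite sum of the
  \<open>\<langle>h, u\<^sub>i\<rangle> v\<^sub>i\<close>.  The \<open>v\<^sub>i\<close> are orthogonal and nonzero, hence linearly independent
  (\<open>orthogonal_sum_eq_0_iff\<close>), so the sum vanishes only if every coefficient does: the kernel of
  \<open>R\<close> is the orthogonal complement of \<open>u\<^sub>1, \<dots>, u\<^sub>n\<close> in \<open>H\<^sup>2\<close>.  It is closed because each
  functional \<open>\<langle>\<cdot>, u\<^sub>i\<rangle>\<close> is bounded (\<open>cmod_inner_L2_unit_le\<close>).

  For any \<open>f \<in> H\<^sup>2\<close> the function \<open>S\<^sup>*f\<close> is again in \<open>H\<^sup>2\<close>, and subtracting its orthogonal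
  projection to the span of the orthonormal \<open>u\<^sub>i\<close> leaves an element of that complement.  This is
  the decomposition required of a defect space.

  The analytic content is therefore that \<open>S\<^sup>*\<close> maps \<open>H\<^sup>2\<close> to itself (\<open>backward_shift_in_H2\<close>).
  On the circle \<open>S\<^sup>*f\<close> has the boundary function \<open>(f(z) - F(0)) / z\<close>, where \<open>F\<close> is the function on
  the disc belonging to \<open>f\<close>, because the radial limits of \<open>F\<close> give those of the quotient.
  The square means of \<open>(F(z) - F(0)) / z\<close> over circles around the origin are controlled by those
  of \<open>F\<close>, except near the origin, where continuity bounds the quotient.
\<close>

section \<open>The inner product\<close>

lemma integrable_mult_cnj:
  assumes "square_integrable f" "square_integrable g"
  shows "integrable circle (\<lambda>z. f z * cnj (g z))"
proof -
  have [measurable]: "f \<in> borel_measurable circle" "g \<in> borel_measurable circle"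
    using assms by (auto simp: square_integrable_def)
  have [measurable]: "cnj \<in> borel_measurable borel"
    by (intro borel_measurable_continuous_onI continuous_intros)
  have int: "integrable circle (\<lambda>z. (cmod (f z))\<^sup>2 + (cmod (g z))\<^sup>2)"
    using assms by (auto simp: square_integrable_def)
  have le: "norm (f z * cnj (g z)) \<le> norm ((cmod (f z))\<^sup>2 + (cmod (g z))\<^sup>2)" for z
  proof -
    have "2 * (cmod (f z) * cmod (g z)) \<le> (cmod (f z))\<^sup>2 + (cmod (g z))\<^sup>2"
      using sum_squares_bound[of "cmod (f z)" "cmod (g z)"] by simp
    moreover have "0 \<le> cmod (f z) * cmod (g z)"
      by simp
    ultimately show ?thesis
      by (simp only: norm_mult complex_mod_cnj real_norm_def)
  qed
  show ?thesis
    by (rule Bochner_Integration.integrable_bound[OF int _ AE_I2[OF le]]) simp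
qed

lemma inner_L2_add_left: "inner_L2 (x + y) w = inner_L2 x w + inner_L2 y w"
  by transfer (auto simp: distrib_right integrable_mult_cnj)

lemma inner_L2_scaleC_left: "inner_L2 (c *\<^sub>C x) w = c * inner_L2 x w"
  by transfer (auto simp: mult.assoc integrable_mult_cnj)

lemma inner_L2_commute: "inner_L2 x y = cnj (inner_L2 y x)"
proof transfer
  fix f g
  have "cnj (LINT z|circle. g z * cnj (f z)) = (LINT z|circle. cnj (g z * cnj (f z)))"
    by (rule Bochner_Integration.integral_cnj[symmetric])
  also have "\<dots> = (LINT z|circle. f z * cnj (g z))"
    by (simp add: mult.commute)
  finally show "(LINT z|circle. f z * cnj (g z)) = cnj (LINT z|circle. g z * cnj (f z))"
    by simp
qed

interpretation inner_left: additive "\<lambda>x. inner_L2 x w"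
  by standard (rule inner_L2_add_left)

lemmas inner_L2_left_simps =
  inner_L2_add_left inner_L2_scaleC_left inner_left.zero inner_left.minus inner_left.diff
  inner_left.sum

lemma inner_L2_diff_right: "inner_L2 w (x - y) = inner_L2 w x - inner_L2 w y"
  using inner_L2_commute[of w] by (simp add: inner_left.diff)

lemma inner_L2_scaleC_right: "inner_L2 w (c *\<^sub>C x) = cnj c * inner_L2 w x"
  using inner_L2_commute[of w] by (simp add: inner_L2_scaleC_left)

lemma integral_mult_cnj_self:
  "(LINT z|M. f z * cnj (f z)) = complex_of_real (LINT z|M. (cmod (f z))\<^sup>2)"
  by (simp only: complex_norm_square[symmetric] integral_complex_of_real)

lemma inner_L2_self_nonneg: "0 \<le> Re (inner_L2 x x)"
  by transfer (simp add: integral_mult_cnj_self)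

lemma inner_L2_self_eq_0D:
  assumes "inner_L2 x x = 0"
  shows "x = 0"
  using assms
proof transfer
  fix f
  assume "square_integrable f \<and> square_integrable f \<and> (AE z in circle. f z = f z)"
    and "(LINT z|circle. f z * cnj (f z)) = 0"
  then have f: "square_integrable f" and 0: "(LINT z|circle. (cmod (f z))\<^sup>2) = 0"
    by (auto simp: integral_mult_cnj_self)
  have "AE z in circle. (cmod (f z))\<^sup>2 = 0"
    by (subst integral_nonneg_eq_0_iff_AE[symmetric]) (use f 0 in \<open>auto simp: square_integrable_def\<close>)
  then show "square_integrable f \<and> square_integrable (\<lambda>_. 0) \<and> (AE z in circle. f z = 0)"
    using f by (simp add: square_integrable_0)
qed

text \<open>
  Bessel's inequality for one vector: \<open>x\<close> minus its component along \<open>e\<close> has nonnegative square norm.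
\<close>
lemma cmod_inner_L2_unit_le:
  assumes "inner_L2 e e = 1"
  shows "cmod (inner_L2 x e) \<le> norm_L2 x"
proof -
  define c where "c = inner_L2 x e"
  have "inner_L2 (x - c *\<^sub>C e) (x - c *\<^sub>C e) = inner_L2 x x - c * cnj c"
    using inner_L2_commute[of e x] assms
    by (simp add: inner_L2_left_simps inner_L2_diff_right inner_L2_scaleC_right c_def algebra_simps)
  then have "(cmod c)\<^sup>2 \<le> Re (inner_L2 x x)"
    using inner_L2_self_nonneg[of "x - c *\<^sub>C e"] by (simp add: complex_mult_cnj cmod_power2)
  then show ?thesis
    unfolding norm_L2_def c_def by (rule real_le_rsqrt)
qed

text \<open>
  Pairing the sum with \<open>v\<^sub>j\<close> isolates \<open>c\<^sub>j \<langle>v\<^sub>j, v\<^sub>j\<rangle>\<close>.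
\<close>
lemma orthogonal_sum_eq_0_iff:
  assumes "finite I"
    and nz: "\<And>i. i \<in> I \<Longrightarrow> v i \<noteq> 0"
    and orth: "\<And>i j. i \<in> I \<Longrightarrow> j \<in> I \<Longrightarrow> i \<noteq> j \<Longrightarrow> inner_L2 (v i) (v j) = 0"
  shows "(\<Sum>i\<in>I. c i *\<^sub>C v i) = 0 \<longleftrightarrow> (\<forall>i\<in>I. c i = 0)"
proof
  assume 0: "(\<Sum>i\<in>I. c i *\<^sub>C v i) = 0"
  show "\<forall>i\<in>I. c i = 0"
  proof
    fix j assume j: "j \<in> I"
    have "0 = inner_L2 (\<Sum>i\<in>I. c i *\<^sub>C v i) (v j)"
      by (simp add: 0 inner_left.zero)
    also have "\<dots> = (\<Sum>i\<in>I. if i = j then c j * inner_L2 (v j) (v j) else 0)"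
      unfolding inner_left.sum by (rule sum.cong) (use orth j in \<open>auto simp: inner_L2_scaleC_left\<close>)
    also have "\<dots> = c j * inner_L2 (v j) (v j)"
      using j assms(1) by simp
    finally show "c j = 0"
      using inner_L2_self_eq_0D nz[OF j] by force
  qed
qed simp

lemma span_orthonormal_has_dimension:
  assumes orth: "\<And>i j. i \<in> {1..n} \<Longrightarrow> j \<in> {1..n} \<Longrightarrow> inner_L2 (u i) (u j) = (if i = j then 1 else 0)"
  shows "has_dimension (L2T.span (u ` {1..n})) n"
proof -
  have inj: "inj_on u {1..n}"
    by (rule inj_onI) (metis orth zero_neq_one)
  have nz: "u i \<noteq> 0" if "i \<in> {1..n}" for i
    using orth[OF that that] by (auto simp: inner_left.zero)
  have "\<not> L2T.dependent (u ` {1..n})"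
  proof
    assume "L2T.dependent (u ` {1..n})"
    then obtain a where a: "\<exists>x\<in>u ` {1..n}. a x \<noteq> 0" "(\<Sum>x\<in>u ` {1..n}. a x *\<^sub>C x) = 0"
      by (auto simp: L2T.dependent_finite)
    have "(\<Sum>i\<in>{1..n}. a (u i) *\<^sub>C u i) = 0"
      using a(2) unfolding sum.reindex[OF inj] by (simp add: o_def)
    then have "\<forall>i\<in>{1..n}. a (u i) = 0"
      by (subst (asm) orthogonal_sum_eq_0_iff) (use nz orth in auto)
    then show False
      using a(1) by auto
  qed
  then show ?thesis
    unfolding has_dimension_def using card_image[OF inj] by (intro exI[of _ "u ` {1..n}"]) auto
qed

section \<open>The circle and the Hardy space\<close>

lemma measurable_circle: "borel_measurable circle = borel_measurable (restrict_space borel (sphere 0 1))"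
  by (rule measurable_cong_sets) (auto simp: circle_def)

lemma space_circle: "space circle = sphere 0 1"
  by (simp add: circle_def space_restrict_space)

lemma cis_measurable:
  "cis \<in> measurable (uniform_measure lborel {0..<2 * pi}) (restrict_space borel (sphere 0 1))"
proof (rule measurable_restrict_space2)
  show "cis \<in> borel_measurable (uniform_measure lborel {0..<2 * pi})"
    by (simp add: measurable_cong_sets[OF sets_uniform_measure refl])
       (intro borel_measurable_continuous_onI continuous_intros)
qed auto

interpretation circle: prob_space circle
  unfolding circle_def
  by (intro prob_space.prob_space_distr prob_space_uniform_measure cis_measurable) auto

lemma square_integrable_continuous:
  assumes "continuous_on (sphere 0 1) f"
  shows "square_integrable f"
proof -
  have meas[measurable]: "f \<in> borel_measurable circle"
    unfolding measurable_circle by (rule borel_measurable_continuous_on_restrict[OF assms])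
  have "bounded (f ` sphere 0 1)"
    by (intro compact_imp_bounded compact_continuous_image assms compact_sphere)
  then obtain B where B: "cmod (f z) \<le> B" if "z \<in> sphere 0 1" for z
    unfolding bounded_iff by blast
  have "integrable circle (\<lambda>z. (cmod (f z))\<^sup>2)"
    by (rule circle.integrable_const_bound[of _ "B\<^sup>2"])
       (auto intro!: AE_I2 power_mono B simp: space_circle)
  then show ?thesis
    by (simp add: square_integrable_def)
qed

lemma continuous_on_circle_dilation:
  assumes "F holomorphic_on ball 0 1" "r \<in> {0..<1}"
  shows "continuous_on (sphere 0 1) (\<lambda>z. F (of_real r * z))"
  by (rule continuous_on_compose2[OF holomorphic_on_imp_continuous_on[OF assms(1)]])
     (use assms(2) in \<open>auto intro!: continuous_intros simp: norm_mult\<close>)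

text \<open>
  The common estimate behind closure of the Hardy class under sums and difference quotients, from
  \<open>(a + b)\<^sup>2 \<le> 2 a\<^sup>2 + 2 b\<^sup>2\<close>.  Domination of \<open>H\<close> is asked only on the
  circle of radius \<open>r\<close>, so that \<open>H\<close> may be the difference quotient away from the origin.
\<close>
lemma integral_square_dilation_le:
  assumes "F holomorphic_on ball 0 1" "G holomorphic_on ball 0 1" "r \<in> {0..<1}"
    and le: "\<And>z. cmod z = 1 \<Longrightarrow> cmod (H (of_real r * z)) \<le> cmod (F (of_real r * z)) + cmod (G (of_real r * z))"
  shows "(LINT z|circle. (cmod (H (of_real r * z)))\<^sup>2) \<le>
    2 * (LINT z|circle. (cmod (F (of_real r * z)))\<^sup>2) + 2 * (LINT z|circle. (cmod (G (of_real r * z)))\<^sup>2)"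
proof -
  have int: "integrable circle (\<lambda>z. (cmod (F (of_real r * z)))\<^sup>2)"
    "integrable circle (\<lambda>z. (cmod (G (of_real r * z)))\<^sup>2)"
    using square_integrable_continuous[OF continuous_on_circle_dilation] assms
    by (auto simp: square_integrable_def)
  have "(cmod (H (of_real r * z)))\<^sup>2
    \<le> 2 * (cmod (F (of_real r * z)))\<^sup>2 + 2 * (cmod (G (of_real r * z)))\<^sup>2" if "z \<in> space circle" for z
  proof -
    have "(cmod (H (of_real r * z)))\<^sup>2 \<le> (cmod (F (of_real r * z)) + cmod (G (of_real r * z)))\<^sup>2"
      by (intro power_mono le) (use that in \<open>auto simp: space_circle\<close>)
    then show ?thesis
      using sum_squares_bound[of "cmod (F (of_real r * z))" "cmod (G (of_real r * z))"]
      by (simp add: power2_sum)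
  qed
  then have "(LINT z|circle. (cmod (H (of_real r * z)))\<^sup>2) \<le>
    (LINT z|circle. 2 * (cmod (F (of_real r * z)))\<^sup>2 + 2 * (cmod (G (of_real r * z)))\<^sup>2)"
    by (intro integral_mono') (use int in auto)
  then show ?thesis
    using int by simp
qed

lemma hardy_discI:
  assumes "F holomorphic_on ball 0 1"
    and "\<And>r. r \<in> {0..<1} \<Longrightarrow> (LINT z|circle. (cmod (F (of_real r * z)))\<^sup>2) \<le> C"
  shows "F \<in> hardy_disc"
  using assms unfolding hardy_disc_def by blast

lemma hardy_disc_add:
  assumes "F \<in> hardy_disc" "G \<in> hardy_disc"
  shows "(\<lambda>z. F z + G z) \<in> hardy_disc"
proof -
  obtain A B where A: "\<And>r. r \<in> {0..<1} \<Longrightarrow> (LINT z|circle. (cmod (F (of_real r * z)))\<^sup>2) \<le> A"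
    and B: "\<And>r. r \<in> {0..<1} \<Longrightarrow> (LINT z|circle. (cmod (G (of_real r * z)))\<^sup>2) \<le> B"
    and hol: "F holomorphic_on ball 0 1" "G holomorphic_on ball 0 1"
    using assms unfolding hardy_disc_def by blast
  have "(LINT z|circle. (cmod (F (of_real r * z) + G (of_real r * z)))\<^sup>2) \<le> 2 * A + 2 * B"
    if "r \<in> {0..<1}" for r
    using integral_square_dilation_le[OF hol that, of "\<lambda>z. F z + G z", OF norm_triangle_ineq]
      A[OF that] B[OF that]
    by linarith
  then show ?thesis
    by (rule hardy_discI[rotated]) (auto intro!: holomorphic_intros hol)
qed

lemma hardy_disc_cmult:
  assumes "F \<in> hardy_disc"
  shows "(\<lambda>z. c * F z) \<in> hardy_disc"
proof -
  obtain A where A: "\<And>r. r \<in> {0..<1} \<Longrightarrow> (LINT z|circle. (cmod (F (of_real r * z)))\<^sup>2) \<le> A"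
    and hol: "F holomorphic_on ball 0 1"
    using assms unfolding hardy_disc_def by blast
  have "(LINT z|circle. (cmod (c * F (of_real r * z)))\<^sup>2) \<le> (cmod c)\<^sup>2 * A" if "r \<in> {0..<1}" for r
    using A[OF that] by (simp add: norm_mult power_mult_distrib mult_left_mono)
  then show ?thesis
    by (rule hardy_discI[rotated]) (auto intro!: holomorphic_intros hol)
qed

lemma has_boundary_values_add:
  assumes "has_boundary_values F f" "has_boundary_values G g"
  shows "has_boundary_values (\<lambda>z. F z + G z) (f + g)"
  using assms by transfer (elim eventually_rev_mp, auto intro!: eventuallyI tendsto_intros)

lemma has_boundary_values_cmult:
  assumes "has_boundary_values F f"
  shows "has_boundary_values (\<lambda>z. c * F z) (c *\<^sub>C f)"
  using assms by transfer (elim eventually_rev_mp, auto intro!: eventuallyI tendsto_intros)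

text \<open>
  This makes the definite description in the definition of the backward shift meaningful.
\<close>
lemma has_boundary_values_unique:
  assumes "has_boundary_values F f" "has_boundary_values F g"
  shows "f = g"
  using assms
proof transfer
  fix F f g
  assume "square_integrable f \<and> square_integrable f \<and> (AE z in circle. f z = f z)"
    "square_integrable g \<and> square_integrable g \<and> (AE z in circle. g z = g z)"
    and F: "AE z in circle. ((\<lambda>r. F (complex_of_real r * z)) \<longlongrightarrow> f z) (at_left 1)"
    and G: "AE z in circle. ((\<lambda>r. F (complex_of_real r * z)) \<longlongrightarrow> g z) (at_left 1)"
  moreover have "AE z in circle. f z = g z"
    using F G by eventually_elim (auto intro: tendsto_unique[rotated])
  ultimately show "square_integrable f \<and> square_integrable g \<and> (AE z in circle. f z = g z)"
    by blast
qed

lemma subspace_H2: "L2T.subspace H2"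
proof (rule L2T.subspaceI)
  have "(\<lambda>_. 0) \<in> hardy_disc"
    by (auto simp: hardy_disc_def)
  moreover have "has_boundary_values (\<lambda>_. 0) 0"
    by transfer auto
  ultimately show "0 \<in> H2"
    by (auto simp: H2_def)
  show "x + y \<in> H2" if "x \<in> H2" "y \<in> H2" for x y
    using that unfolding H2_def by (blast intro: hardy_disc_add has_boundary_values_add)
  show "c *\<^sub>C x \<in> H2" if "x \<in> H2" for c x
    using that unfolding H2_def by (blast intro: hardy_disc_cmult has_boundary_values_cmult)
qed

section \<open>The backward shift\<close>

text \<open>
  The value at the origin was chosen to remove the singularity there.
\<close>
lemma backward_shift_disc_holomorphic:
  assumes "F holomorphic_on ball 0 1"
  shows "backward_shift_disc F holomorphic_on ball 0 1"
proof -
  have "(\<lambda>z. if z = 0 then deriv F 0 else (F z - F 0) / (z - 0)) holomorphic_on ball 0 1"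
    by (rule pole_lemma_open) (use assms in auto)
  then show ?thesis
    by (simp add: backward_shift_disc_def[abs_def] cong: if_cong)
qed

text \<open>
  For \<open>r \<le> 1/2\<close> the quotient is bounded by compactness of the smaller disc; for \<open>r > 1/2\<close> the
  denominator costs at most a factor \<open>2\<close>, which leaves the square means of \<open>F\<close> and a constant.
\<close>
lemma backward_shift_disc_hardy:
  assumes "F \<in> hardy_disc"
  shows "backward_shift_disc F \<in> hardy_disc"
proof -
  let ?G = "backward_shift_disc F"
  obtain A where A: "\<And>r. r \<in> {0..<1} \<Longrightarrow> (LINT z|circle. (cmod (F (of_real r * z)))\<^sup>2) \<le> A"
    and hol: "F holomorphic_on ball 0 1"
    using assms unfolding hardy_disc_def by blast
  note holG = backward_shift_disc_holomorphic[OF hol]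
  have "compact (?G ` cball 0 (1/2))"
    by (intro compact_continuous_image holomorphic_on_imp_continuous_on
        holomorphic_on_subset[OF holG]) auto
  then have "bounded (?G ` cball 0 (1/2))"
    by (rule compact_imp_bounded)
  then obtain B where "\<forall>z\<in>cball 0 (1/2). cmod (?G z) \<le> B"
    by (auto simp only: bounded_iff ball_simps)
  then have B: "cmod (?G z) \<le> B" if "cmod z \<le> 1/2" for z
    using that by simp
  \<comment> \<open>The factor 8 is 2 from squaring a sum of two terms and 4 from squaring \<open>1/r < 2\<close>.\<close>
  define C where "C = max (B\<^sup>2) (8 * A + 8 * (cmod (F 0))\<^sup>2)"
  have "(LINT z|circle. (cmod (?G (of_real r * z)))\<^sup>2) \<le> C" if r: "r \<in> {0..<1}" for r
  proof (cases "r \<le> 1/2")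
    case True
    have "(LINT z|circle. (cmod (?G (of_real r * z)))\<^sup>2) \<le> (LINT z|circle. B\<^sup>2)"
      by (intro integral_mono' power_mono B)
         (use True r in \<open>auto simp: space_circle norm_mult\<close>)
    then show ?thesis
      by (simp add: C_def circle.prob_space)
  next
    case False
    have le: "cmod (?G (of_real r * z)) \<le> cmod (2 * F (of_real r * z)) + cmod (2 * F 0)"
      if "cmod z = 1" for z
    proof -
      have nz: "of_real r * z \<noteq> 0"
        using that False by auto
      have "cmod (?G (of_real r * z)) = cmod (F (of_real r * z) - F 0) / r"
        using nz that False by (simp add: backward_shift_disc_def norm_divide norm_mult)
      also have "\<dots> \<le> cmod (F (of_real r * z) - F 0) / (1/2)"
        by (intro divide_left_mono) (use False in auto)
      also have "\<dots> \<le> cmod (2 * F (of_real r * z)) + cmod (2 * F 0)"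
        using norm_triangle_ineq4[of "F (of_real r * z)" "F 0"] by (simp add: norm_mult)
      finally show ?thesis .
    qed
    have "(LINT z|circle. (cmod (?G (of_real r * z)))\<^sup>2)
      \<le> 2 * (LINT z|circle. (cmod (2 * F (of_real r * z)))\<^sup>2) + 2 * (LINT z|circle. (cmod (2 * F 0))\<^sup>2)"
      by (rule integral_square_dilation_le[of "\<lambda>z. 2 * F z" "\<lambda>_. 2 * F 0"])
         (use r hol le in \<open>auto intro!: holomorphic_intros\<close>)
    also have "\<dots> \<le> 8 * A + 8 * (cmod (F 0))\<^sup>2"
      using A[OF r] by (simp add: norm_mult power_mult_distrib circle.prob_space)
    finally show ?thesis
      by (simp add: C_def)
  qed
  then show ?thesis
    by (rule hardy_discI[OF holG])
qed

text \<open>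
  Along almost every radius the quotient tends to \<open>(f z - F 0) / z\<close>, and dividing by \<open>z\<close> on the
  circle is multiplication by a bounded function, so the limit is square integrable.
\<close>
lemma backward_shift_disc_boundary_values:
  assumes "has_boundary_values F f"
  shows "\<exists>h. has_boundary_values (backward_shift_disc F) h"
  using assms
proof transfer
  fix F f
  assume "square_integrable f \<and> square_integrable f \<and> (AE z in circle. f z = f z)"
    and lim: "AE z in circle. ((\<lambda>r. F (complex_of_real r * z)) \<longlongrightarrow> f z) (at_left 1)"
  then have f: "square_integrable f" by blast
  have [measurable]: "f \<in> borel_measurable circle"
    using f by (simp add: square_integrable_def)
  have d: "square_integrable (\<lambda>z. f z - F 0)"
    by (intro square_integrable_diff f square_integrable_continuous continuous_intros)
  have "(\<lambda>z. inverse z) \<in> borel_measurable circle"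
    unfolding measurable_circle
    by (intro borel_measurable_continuous_on_restrict continuous_intros) auto
  then have "ess_bounded inverse"
    unfolding ess_bounded_def
    by (intro conjI exI[of _ 1] AE_I2) (auto simp: space_circle norm_inverse)
  from square_integrable_mult[OF this d]
  have si: "square_integrable (\<lambda>z. inverse z * (f z - F 0))" .
  have "AE z in circle.
    ((\<lambda>r. backward_shift_disc F (complex_of_real r * z)) \<longlongrightarrow> inverse z * (f z - F 0)) (at_left 1)"
    using lim AE_space
  proof eventually_elim
    case (elim z)
    then have z: "z \<noteq> 0" by (auto simp: space_circle)
    have "((\<lambda>r. (F (complex_of_real r * z) - F 0) / (complex_of_real r * z))
        \<longlongrightarrow> (f z - F 0) / (complex_of_real 1 * z)) (at_left 1)"
      by (intro tendsto_intros elim) (use z in auto)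
    moreover have "\<forall>\<^sub>F r in at_left 1. (F (complex_of_real r * z) - F 0) / (complex_of_real r * z)
        = backward_shift_disc F (complex_of_real r * z)"
      using eventually_at_left_real[OF zero_less_one]
      by eventually_elim (auto simp: backward_shift_disc_def z)
    ultimately have "((\<lambda>r. backward_shift_disc F (complex_of_real r * z))
        \<longlongrightarrow> (f z - F 0) / (complex_of_real 1 * z)) (at_left 1)"
      by (rule Lim_transform_eventually)
    then show ?case
      by (simp add: divide_inverse mult.commute)
  qed
  then show "\<exists>h\<in>{h. square_integrable h \<and> square_integrable h \<and> (AE z in circle. h z = h z)}.
      AE z in circle. ((\<lambda>r. backward_shift_disc F (complex_of_real r * z)) \<longlongrightarrow> h z) (at_left 1)"
    using si by auto
qed

text \<open>
  By uniqueness of boundary values, \<open>backward_shift f\<close> is the boundary function of the difference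
  quotient of \<open>disc_fun f\<close>, and that quotient lies in the Hardy class.
\<close>
lemma backward_shift_in_H2:
  assumes "f \<in> H2"
  shows "backward_shift f \<in> H2"
proof -
  have "\<exists>F. F \<in> hardy_disc \<and> has_boundary_values F f"
    using assms by (auto simp: H2_def)
  then have F: "disc_fun f \<in> hardy_disc" "has_boundary_values (disc_fun f) f"
    unfolding disc_fun_def by (metis (mono_tags, lifting) someI_ex)+
  have "\<exists>!h. has_boundary_values (backward_shift_disc (disc_fun f)) h"
    using backward_shift_disc_boundary_values[OF F(2)] has_boundary_values_unique by blast
  then have "has_boundary_values (backward_shift_disc (disc_fun f)) (backward_shift f)"
    unfolding backward_shift_def by (rule theI')
  then show ?thesis
    using backward_shift_disc_hardy[OF F(1)] by (auto simp: H2_def)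
qed

section \<open>Near invariance of the kernel\<close>

text \<open>
  The product is already zero in \<open>L\<^sup>2\<close>.  Its projection is a definite description, for which \<open>0\<close> is
  the only candidate: a \<open>p \<in> H\<^sup>2\<close> with \<open>- p\<close> orthogonal to \<open>H\<^sup>2\<close> is orthogonal to itself.
\<close>
lemma toeplitz_AE_0:
  assumes "ess_bounded g" "AE z in circle. g z = 0"
  shows "toeplitz g h = 0"
proof -
  have "mult_L2 g h = 0"
    using assms
  proof transfer
    fix g h
    assume g: "ess_bounded g" "AE z in circle. g z = 0"
      and h: "square_integrable h \<and> square_integrable h \<and> (AE z in circle. h z = h z)"
    from g(2) have "AE z in circle. g z * h z = 0"
      by eventually_elim simp
    then show "square_integrable (if ess_bounded g then \<lambda>z. g z * h z else (\<lambda>_. 0)) \<and>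
        square_integrable (\<lambda>_. 0) \<and>
        (AE z in circle. (if ess_bounded g then \<lambda>z. g z * h z else (\<lambda>_. 0)) z = 0)"
      using g(1) h by (simp add: square_integrable_0 square_integrable_mult)
  qed
  moreover have "orthogonal_projection H2 0 = 0"
    unfolding orthogonal_projection_def
  proof (rule the_equality)
    show "0 \<in> H2 \<and> (\<forall>q\<in>H2. inner_L2 (0 - 0) q = 0)"
      by (simp add: L2T.subspace_0[OF subspace_H2] inner_left.zero)
    show "p = 0" if "p \<in> H2 \<and> (\<forall>q\<in>H2. inner_L2 (0 - p) q = 0)" for p
      using that by (auto intro!: inner_L2_self_eq_0D simp: inner_left.minus)
  qed
  ultimately show ?thesis
    by (simp add: toeplitz_def)
qed

text \<open>
  Closedness: if \<open>x\<^sub>k\<close> is orthogonal to \<open>u\<^sub>i\<close>, then \<open>\<bar>\<langle>h, u\<^sub>i\<rangle>\<bar> \<le> \<parallel>x\<^sub>k - h\<parallel>\<close> by Bessel's inequality.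
\<close>
lemma closed_subspace_H2_orthogonal_complement:
  assumes unit: "\<And>i. i \<in> I \<Longrightarrow> inner_L2 (u i) (u i) = 1"
  shows "closed_subspace_H2 {h \<in> H2. \<forall>i\<in>I. inner_L2 h (u i) = 0}"
  unfolding closed_subspace_H2_def
proof (intro conjI allI impI)
  show "L2T.subspace {h \<in> H2. \<forall>i\<in>I. inner_L2 h (u i) = 0}"
    using subspace_H2 by (auto simp: L2T.subspace_def inner_L2_left_simps)
next
  fix x :: "nat \<Rightarrow> L2T" and h
  assume "(\<forall>k. x k \<in> {h \<in> H2. \<forall>i\<in>I. inner_L2 h (u i) = 0}) \<and> h \<in> H2 \<and>
    (\<lambda>k. norm_L2 (x k - h)) \<longlonglongrightarrow> 0"
  then have x: "\<And>k i. i \<in> I \<Longrightarrow> inner_L2 (x k) (u i) = 0" and h: "h \<in> H2"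
    and lim: "(\<lambda>k. norm_L2 (x k - h)) \<longlonglongrightarrow> 0"
    by auto
  have "inner_L2 h (u i) = 0" if i: "i \<in> I" for i
  proof -
    have "cmod (inner_L2 h (u i)) \<le> norm_L2 (x k - h)" for k
      using cmod_inner_L2_unit_le[OF unit[OF i], of "x k - h"] x[OF i]
      by (simp add: inner_left.diff)
    then have "cmod (inner_L2 h (u i)) \<le> 0"
      by (intro LIMSEQ_le_const[OF lim]) auto
    then show ?thesis by simp
  qed
  with h show "h \<in> {h \<in> H2. \<forall>i\<in>I. inner_L2 h (u i) = 0}" by blast
qed auto

text \<open>
  \<open>S\<^sup>*f\<close> splits into its orthogonal projection \<open>y\<close> to the span of the \<open>u\<^sub>i\<close>, given by the Fourier
  coefficients, and a remainder that stays in \<open>H\<^sup>2\<close> because \<open>S\<^sup>*f\<close> and all \<open>u\<^sub>i\<close> do.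
\<close>
lemma orthogonal_complement_defect_space:
  assumes u: "\<And>i. i \<in> {1..n} \<Longrightarrow> u i \<in> H2"
    and orth: "\<And>i j. i \<in> {1..n} \<Longrightarrow> j \<in> {1..n} \<Longrightarrow> inner_L2 (u i) (u j) = (if i = j then 1 else 0)"
  shows "defect_space {h \<in> H2. \<forall>i\<in>{1..n}. inner_L2 h (u i) = 0} n (L2T.span (u ` {1..n}))"
  unfolding defect_space_def
proof (intro conjI ballI impI)
  show sub: "L2T.span (u ` {1..n}) \<subseteq> H2"
    by (rule L2T.span_minimal) (use u subspace_H2 in auto)
  show "has_dimension (L2T.span (u ` {1..n})) n"
    by (rule span_orthonormal_has_dimension[OF orth])
  fix f
  assume "f \<in> {h \<in> H2. \<forall>i\<in>{1..n}. inner_L2 h (u i) = 0}"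
  then have s: "backward_shift f \<in> H2"
    by (auto intro: backward_shift_in_H2)
  define y where "y = (\<Sum>i\<in>{1..n}. inner_L2 (backward_shift f) (u i) *\<^sub>C u i)"
  have y: "y \<in> L2T.span (u ` {1..n})"
    unfolding y_def by (intro L2T.span_sum L2T.span_scale L2T.span_base) auto
  have "inner_L2 y (u j) = inner_L2 (backward_shift f) (u j)" if j: "j \<in> {1..n}" for j
  proof -
    have "inner_L2 y (u j) = (\<Sum>i\<in>{1..n}. if i = j then inner_L2 (backward_shift f) (u j) else 0)"
      unfolding y_def inner_left.sum
      by (rule sum.cong) (use orth j in \<open>auto simp: inner_L2_scaleC_left\<close>)
    then show ?thesis using j by simp
  qed
  moreover have "backward_shift f - y \<in> H2"
    using L2T.subspace_diff[OF subspace_H2 s] y sub by blast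
  ultimately have "backward_shift f - y \<in> {h \<in> H2. \<forall>i\<in>{1..n}. inner_L2 h (u i) = 0}"
    by (simp add: inner_left.diff)
  with y show "\<exists>x\<in>{h \<in> H2. \<forall>i\<in>{1..n}. inner_L2 h (u i) = 0}.
      \<exists>y\<in>L2T.span (u ` {1..n}). backward_shift f = x + y"
    by (intro bexI[of _ "backward_shift f - y"] bexI[of _ y]) (auto simp only: diff_add_cancel)
qed auto

theorem proposition2p2:
  fixes n :: nat and u v :: "nat \<Rightarrow> L2T" and g :: "complex \<Rightarrow> complex" and R :: "L2T \<Rightarrow> L2T"
  assumes "n \<ge> 1"
    and "\<And>i. i \<in> {1..n} \<Longrightarrow> u i \<in> H2"
    and "\<And>i j. i \<in> {1..n} \<Longrightarrow> j \<in> {1..n} \<Longrightarrow> inner_L2 (u i) (u j) = (if i = j then 1 else 0)"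
    and "\<And>i. i \<in> {1..n} \<Longrightarrow> v i \<in> H2"
    and "\<And>i. i \<in> {1..n} \<Longrightarrow> v i \<noteq> 0"
    and "\<And>i j. i \<in> {1..n} \<Longrightarrow> j \<in> {1..n} \<Longrightarrow> i \<noteq> j \<Longrightarrow> inner_L2 (v i) (v j) = 0"
    and "ess_bounded g"
    and "AE z in circle. g z = 0"
    and "\<And>h. h \<in> H2 \<Longrightarrow> R h = toeplitz g h + (\<Sum>i = 1..n. inner_L2 h (u i) *\<^sub>C v i)"
  shows "nearly_invariant_with_defect (kernel_H2 R) n \<and>
         defect_space (kernel_H2 R) n (L2T.span (u ` {1..n}))"
proof -
  have "R h = 0 \<longleftrightarrow> (\<forall>i\<in>{1..n}. inner_L2 h (u i) = 0)" if "h \<in> H2" for h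
    using orthogonal_sum_eq_0_iff[of "{1..n}" v] assms(5,6)
    by (simp add: assms(9)[OF that] toeplitz_AE_0[OF assms(7,8)])
  then have ker: "kernel_H2 R = {h \<in> H2. \<forall>i\<in>{1..n}. inner_L2 h (u i) = 0}"
    by (auto simp: kernel_H2_def)
  have "defect_space (kernel_H2 R) n (L2T.span (u ` {1..n}))"
    unfolding ker by (rule orthogonal_complement_defect_space[OF assms(2,3)])
  moreover have "closed_subspace_H2 (kernel_H2 R)"
    unfolding ker by (rule closed_subspace_H2_orthogonal_complement) (simp add: assms(3))
  ultimately show ?thesis
    by (auto simp: nearly_invariant_with_defect_def)
qed

end
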